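(* Let $\mathcal J$ be an ideal on $\omega$. (1) The following conditions are equivalent: (a) $\mathcal J$ is extendable to a selective ideal (i.e. $\mathcal J\subseteq\mathcal J'$ for some selective ideal $\mathcal J'$ on $\omega$); (b) $\mathcal{ED}\not\preceq^{\omega_1}_{\omega^\omega,1-1}\mathcal J$; (c) $\mathcal{ED}\not\preceq^{\omega_1}_{\omega^\omega,\mathrm{Fin}-1}\mathcal J$; (d) $\mathcal{ED}\not\preceq^{\omega_1}_{\omega^\omega,\omega^\omega}\mathcal J$. (2) Under CH, the conditions (a), (b), (c), (d) listed in (1) are equivalent to each of the following: (e) there is a selective ultrafilter which is not a $\mathcal J$-point; (f) there is a selective ultrafilter which is not a weak $\mathcal J$-ultrafilter; (g) there is a selective ultrafilter which is not a $\mathcal J$-ultrafilter.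
   Context: An ideal on a set $X$ is a family of subsets of $X$ closed under finite unions and subsets, containing all finite subsets of $X$ and not containing $X$; $\mathcal J^+=\mathcal P(X)\setminus\mathcal J$. Ideals on countably infinite sets are regarded as ideals on $\omega$ via fixed bijections. $\mathcal{ED}=\{A\subseteq\omega\times\omega:\exists m$ such that for all but finitely many $n$, $|\{k:(n,k)\in A\}|<m\}$. $\mathcal J$ is a selective ideal if for every decreasing sequence $(A_n)_{n\in\omega}$ of sets in $\mathcal J^+$ there is $A\in\mathcal J^+$, $A\subseteq A_0$, such that $|A\cap(A_n\setminus A_{n+1})|\le1$ for every $n$. For $\mathcal F\subseteq\omega^\omega$ and ideals $\mathcal I,\mathcal K$ on $\omega$, $\mathcal I\le_{\mathcal F}\mathcal K$ means that there is $f\in\mathcal F$ with $f^{-1}[B]\in\mathcal K$ for every $B\in\mathcal I$. $\mathrm{Fin}-1$ and $1-1$ denote the families of all finite-to-one, respectively one-to-one, functions $\omega\to\omega$. For an ideal $\mathcal K$ on $\omega$ and $\mathcal A\subseteq\mathcal P(\omega)$, $\mathcal K(\mathcal A)=\{B\subseteq\omega:\exists F\in[\mathcal A]^{<\omega}\ (B\setminus\bigcup F\in\mathcal K)\}$. $\mathcal I\preceq^{\omega_1}_{\mathcal F,\mathcal G}\mathcal J$ means: for each ideal $\mathcal J'$ on $\omega$ with $\mathcal J\le_{\mathcal G}\mathcal J'$ there is a countable $\mathcal A\subseteq\mathcal P(\omega)$ with $\omega\notin\mathcal J'(\mathcal A)$ and $\mathcal I\le_{\mathcal F}\mathcal J'(\mathcal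 A)$. Ultrafilters on $\omega$ contain all cofinite sets; $\mathcal U^*=\{\omega\setminus A:A\in\mathcal U\}$. $\mathcal U$ is a selective (Ramsey) ultrafilter if $\mathcal U^*$ is a selective ideal. $\mathcal U$ is a $\mathcal J$-ultrafilter (weak $\mathcal J$-ultrafilter, $\mathcal J$-point) if $\mathcal J\not\le_{\mathcal F}\mathcal U^*$ for $\mathcal F=\omega^\omega$ ($\mathrm{Fin}-1$, $1-1$, respectively). *)

theory Defs
  imports Complex_Main "HOL-Library.Countable_Set" "HOL-Library.Infinite_Set" "HOL-Library.Nat_Bijection"
begin

text \<open>Ideals on the underlying set of a type. The empty family of finite unions is covered,
  since the empty set is finite.\<close>

definition is_ideal :: "'a set set \<Rightarrow> bool" where
  "is_ideal J \<longleftrightarrow>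
     (\<forall>A\<in>J. \<forall>B\<in>J. A \<union> B \<in> J) \<and>
     (\<forall>A\<in>J. \<forall>B. B \<subseteq> A \<longrightarrow> B \<in> J) \<and>
     (\<forall>A. finite A \<longrightarrow> A \<in> J) \<and>
     UNIV \<notin> J"

definition positive :: "'a set set \<Rightarrow> 'a set set" where
  "positive J = - J"

text \<open>As \<^const>\<open>card\<close> is \<open>0\<close> on infinite sets, every upper bound on a cardinality below is
  accompanied by finiteness.\<close>

definition selective_ideal :: "'a set set \<Rightarrow> bool" where
  "selective_ideal J \<longleftrightarrow> is_ideal J \<and>
     (\<forall>A :: nat \<Rightarrow> 'a set. decseq A \<and> (\<forall>n. A n \<in> positive J) \<longrightarrow>
        (\<exists>B\<in>positive J. B \<subseteq> A 0 \<and>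
           (\<forall>n. finite (B \<inter> (A n - A (Suc n))) \<and> card (B \<inter> (A n - A (Suc n))) \<le> 1)))"

definition extendable_to_selective :: "'a set set \<Rightarrow> bool" where
  "extendable_to_selective J \<longleftrightarrow> (\<exists>J'. selective_ideal J' \<and> J \<subseteq> J')"

definition ED :: "(nat \<times> nat) set set" where
  "ED = {A. \<exists>m. \<forall>\<^sub>\<infinity>n. finite {k. (n, k) \<in> A} \<and> card {k. (n, k) \<in> A} < m}"

text \<open>\<open>ED\<close> regarded as an ideal on \<open>\<omega>\<close>; the fixed bijection is Cantor's pairing function.\<close>

definition ED_omega :: "nat set set" where
  "ED_omega = (\<lambda>A. prod_encode ` A) ` ED"

definition fin_to_one :: "(nat \<Rightarrow> nat) set" where
  "fin_to_one = {f. \<forall>n. finite (f -` {n})}"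

definition one_to_one :: "(nat \<Rightarrow> nat) set" where
  "one_to_one = {f. inj f}"

definition order_via :: "(nat \<Rightarrow> nat) set \<Rightarrow> nat set set \<Rightarrow> nat set set \<Rightarrow> bool" where
  "order_via F I K \<longleftrightarrow> (\<exists>f\<in>F. \<forall>B\<in>I. f -` B \<in> K)"

text \<open>The family \<open>K(\<A>)\<close>; it is an ideal only if it omits \<open>\<omega>\<close>.\<close>

definition extend :: "nat set set \<Rightarrow> nat set set \<Rightarrow> nat set set" where
  "extend K \<A> = {B. \<exists>F. finite F \<and> F \<subseteq> \<A> \<and> B - \<Union>F \<in> K}"

text \<open>\<open>prec_omega1 F G I J\<close> is \<open>I \<preceq> J\<close> with superscript \<open>\<omega>\<^sub>1\<close> and subscripts \<open>F, G\<close>.\<close>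

definition prec_omega1 ::
    "(nat \<Rightarrow> nat) set \<Rightarrow> (nat \<Rightarrow> nat) set \<Rightarrow> nat set set \<Rightarrow> nat set set \<Rightarrow> bool" where
  "prec_omega1 F G I J \<longleftrightarrow>
     (\<forall>J'. is_ideal J' \<and> order_via G J J' \<longrightarrow>
        (\<exists>\<A>. countable \<A> \<and> UNIV \<notin> extend J' \<A> \<and> order_via F I (extend J' \<A>)))"

definition is_ultrafilter :: "nat set set \<Rightarrow> bool" where
  "is_ultrafilter U \<longleftrightarrow>
     {} \<notin> U \<and>
     (\<forall>A\<in>U. \<forall>B\<in>U. A \<inter> B \<in> U) \<and>
     (\<forall>A\<in>U. \<forall>B. A \<subseteq> B \<longrightarrow> B \<in> U) \<and>
     (\<forall>A. A \<in> U \<or> - A \<in> U) \<and>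
     (\<forall>A. finite (- A) \<longrightarrow> A \<in> U)"

definition dual :: "nat set set \<Rightarrow> nat set set" where
  "dual U = uminus ` U"

definition selective_ultrafilter :: "nat set set \<Rightarrow> bool" where
  "selective_ultrafilter U \<longleftrightarrow> is_ultrafilter U \<and> selective_ideal (dual U)"

text \<open>The following three notions are only used for ultrafilters \<open>U\<close>.\<close>

definition J_ultrafilter :: "nat set set \<Rightarrow> nat set set \<Rightarrow> bool" where
  "J_ultrafilter J U \<longleftrightarrow> \<not> order_via UNIV J (dual U)"

definition weak_J_ultrafilter :: "nat set set \<Rightarrow> nat set set \<Rightarrow> bool" where
  "weak_J_ultrafilter J U \<longleftrightarrow> \<not> order_via fin_to_one J (dual U)"

definition J_point :: "nat set set \<Rightarrow> nat set set \<Rightarrow> bool" where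
  "J_point J U \<longleftrightarrow> \<not> order_via one_to_one J (dual U)"

text \<open>The continuum hypothesis in the form \<open>2\<close> to the \<open>\<aleph>\<^sub>0\<close> equals \<open>\<aleph>\<^sub>1\<close>: the power set of
  \<open>\<omega>\<close> has the successor cardinal of \<open>\<omega>\<close> as its cardinality.\<close>

definition CH :: bool where
  "CH \<longleftrightarrow> (card_of (UNIV :: nat set set), cardSuc natLeq) \<in> ordIso"

end

theory Submission
  imports Defs
begin

text \<open>
  Selectivity of an ideal yields pseudo-intersections of decreasing sequences of positive sets, and
  positive sets on which a given function is constant or injective. Hence if \<open>J'\<close> is selective and
  \<open>\<A>\<close> is countable, a map witnessing \<open>ED \<le> J'(\<A>)\<close> would be injective on columns on some
  positive set almost disjoint from all of \<open>\<A>\<close>, whose image lies in \<open>ED\<close>. Conversely, applying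
  \<open>ED \<not>\<le> J'(\<A>)\<close> to the complements \<open>\<A>\<close> of a decreasing sequence of positive sets gives a positive
  set with boundedly many points in every difference, which splits into finitely many selectors; so
  \<open>J'\<close> is itself selective, and selectivity passes from \<open>J'\<close> to its push-forward under any map, which
  contains \<open>J\<close> if the map witnesses \<open>J \<le> J'\<close>. Under CH a selective ideal extends to the dual of a
  selective ultrafilter by a tower of positive sets indexed by \<open>\<omega>\<^sub>1\<close> that treats all functions
  \<open>\<omega> \<rightarrow> \<omega>\<close>.
\<close>

section \<open>Ideals and selectivity\<close>

lemma ideal_Un: "is_ideal J \<Longrightarrow> A \<in> J \<Longrightarrow> B \<in> J \<Longrightarrow> A \<union> B \<in> J"
  and ideal_subset: "is_ideal J \<Longrightarrow> A \<in> J \<Longrightarrow> B \<subseteq> A \<Longrightarrow> B \<in> J"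
  and ideal_finite: "is_ideal J \<Longrightarrow> finite A \<Longrightarrow> A \<in> J"
  and ideal_proper: "is_ideal J \<Longrightarrow> UNIV \<notin> J"
  unfolding is_ideal_def by blast+

lemma ideal_UN:
  assumes "is_ideal J" "finite I" "\<And>i. i \<in> I \<Longrightarrow> A i \<in> J"
  shows "(\<Union>i\<in>I. A i) \<in> J"
  using assms(2,3)
  by (induction I) (auto intro: ideal_Un[OF assms(1)] ideal_finite[OF assms(1)])

lemma ideal_almost_subset:
  assumes "is_ideal J" "B \<in> J" "finite (A - B)"
  shows "A \<in> J"
  by (rule ideal_subset[OF assms(1) ideal_Un[OF assms(1,2) ideal_finite[OF assms(1,3)]]]) auto

lemma positive_infinite: "is_ideal J \<Longrightarrow> B \<in> positive J \<Longrightarrow> infinite B"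
  using ideal_finite by (auto simp: positive_def)

lemma selective_imp_ideal: "selective_ideal J \<Longrightarrow> is_ideal J"
  by (simp add: selective_ideal_def)

lemma card_le_one_eq:
  assumes "finite S" "card S \<le> 1" "x \<in> S" "y \<in> S"
  shows "x = y"
  using assms card_le_Suc0_iff_eq[of S] by auto

lemma selectiveE:
  assumes "selective_ideal J" "decseq A" "\<And>n. A n \<in> positive J"
  obtains B where "B \<in> positive J" "B \<subseteq> A 0"
    "\<And>n x y. x \<in> B \<Longrightarrow> y \<in> B \<Longrightarrow> x \<in> A n - A (Suc n) \<Longrightarrow> y \<in> A n - A (Suc n) \<Longrightarrow> x = y"
proof -
  obtain B where B: "B \<in> positive J" "B \<subseteq> A 0"
    "\<And>n. finite (B \<inter> (A n - A (Suc n)))" "\<And>n. card (B \<inter> (A n - A (Suc n))) \<le> 1"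
    using assms unfolding selective_ideal_def by meson
  show thesis
    by (rule that[OF B(1,2)]) (use card_le_one_eq[OF B(3,4)] in blast)
qed

lemma selectiveI:
  assumes "is_ideal J"
    and "\<And>A. decseq A \<Longrightarrow> (\<And>n. A n \<in> positive J) \<Longrightarrow>
      \<exists>B\<in>positive J. B \<subseteq> A 0 \<and>
        (\<forall>n. \<forall>x\<in>B \<inter> (A n - A (Suc n)). \<forall>y\<in>B \<inter> (A n - A (Suc n)). x = y)"
  shows "selective_ideal J"
  unfolding selective_ideal_def
proof (intro conjI assms(1) allI impI)
  fix A :: "nat \<Rightarrow> 'a set"
  assume "decseq A \<and> (\<forall>n. A n \<in> positive J)"
  then obtain B where B: "B \<in> positive J" "B \<subseteq> A 0"
    "\<forall>n. \<forall>x\<in>B \<inter> (A n - A (Suc n)). \<forall>y\<in>B \<inter> (A n - A (Suc n)). x = y"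
    using assms(2)[of A] by blast
  have card: "finite S \<and> card S \<le> 1" if "\<forall>x\<in>S. \<forall>y\<in>S. x = y" for S :: "'a set"
  proof (cases "S = {}")
    case False
    then obtain x where "x \<in> S" by blast
    with that have "S = {x}" by blast
    then show ?thesis by simp
  qed simp
  show "\<exists>B\<in>positive J. B \<subseteq> A 0 \<and>
      (\<forall>n. finite (B \<inter> (A n - A (Suc n))) \<and> card (B \<inter> (A n - A (Suc n))) \<le> 1)"
    by (intro bexI[of _ B] conjI[OF B(2)] allI card B(1)) (use B(3) in blast)
qed

section \<open>Consequences of selectivity\<close>

lemma decseq_almost_subset:
  assumes "B \<subseteq> A 0" "\<And>n. finite (B \<inter> (A n - A (Suc n)))"
  shows "finite (B - A n)"
proof (induction n)
  case 0
  from assms(1) have "B - A 0 = {}" by blast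
  then show ?case by (metis finite.emptyI)
next
  case (Suc n)
  have "B - A (Suc n) \<subseteq> (B - A n) \<union> (B \<inter> (A n - A (Suc n)))" by blast
  with Suc assms(2)[of n] show ?case by (meson finite_UnI finite_subset)
qed

text \<open>A selector inside \<open>A 0\<close> has at most one point in each difference, so it
  loses only finitely many points on the way down to \<open>A n\<close>.\<close>

lemma selective_pseudo_intersection:
  assumes "selective_ideal J" "decseq A" "\<And>n. A n \<in> positive J"
  obtains B where "B \<in> positive J" "\<And>n. finite (B - A n)"
proof -
  obtain B where B: "B \<in> positive J" "B \<subseteq> A 0" "\<And>n. finite (B \<inter> (A n - A (Suc n)))"
    using assms unfolding selective_ideal_def by meson
  show thesis by (rule that[OF B(1) decseq_almost_subset[of B A, OF B(2,3)]])
qed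

text \<open>The sets \<open>{x\<in>B. g x \<ge> n}\<close> decrease and their successive differences
  are the fibres of \<open>g\<close> on \<open>B\<close>. If all are positive, a selector is a set
  on which \<open>g\<close> is injective; otherwise \<open>B\<close> is, modulo \<open>J\<close>, a
  finite union of fibres, one of which is positive.\<close>

lemma selective_const_or_inj:
  fixes g :: "'a \<Rightarrow> nat"
  assumes sel: "selective_ideal J" and B: "B \<in> positive J"
  obtains C where "C \<in> positive J" "C \<subseteq> B" "(\<exists>c. \<forall>x\<in>C. g x = c) \<or> inj_on g C"
proof -
  note J = selective_imp_ideal[OF sel]
  define A where "A n = {x\<in>B. g x \<ge> n}" for n
  show thesis
  proof (cases "\<forall>n. A n \<in> positive J")
    case True
    have "decseq A" by (auto simp: A_def decseq_def)
    then obtain C where C: "C \<in> positive J" "C \<subseteq> A 0"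
      "\<And>n x y. x \<in> C \<Longrightarrow> y \<in> C \<Longrightarrow> x \<in> A n - A (Suc n) \<Longrightarrow> y \<in> A n - A (Suc n) \<Longrightarrow> x = y"
      by (rule selectiveE[OF sel _ True[rule_format]]) (rule that)
    have "inj_on g C"
    proof (rule inj_onI)
      fix x y assume "x \<in> C" "y \<in> C" "g x = g y"
      then show "x = y"
        using C(3)[of x y "g x"] C(2) by (auto simp: A_def)
    qed
    with C that show thesis by (auto simp: A_def)
  next
    case False
    then obtain n where n: "A n \<in> J" by (auto simp: positive_def)
    have "\<exists>i<n. {x\<in>B. g x = i} \<in> positive J"
    proof (rule ccontr)
      assume "\<not> ?thesis"
      then have "(\<Union>i\<in>{..<n}. {x\<in>B. g x = i}) \<in> J"
        by (intro ideal_UN[OF J]) (auto simp: positive_def)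
      from ideal_Un[OF J n this] have "B \<in> J"
        by (rule ideal_subset[OF J]) (auto simp: A_def)
      with B show False by (simp add: positive_def)
    qed
    then show thesis using that by blast
  qed
qed

text \<open>This keeps the transfinite construction of a tower going: finite intersections along an
  enumeration of \<open>T\<close> remain positive, and a pseudo-intersection of them is almost
  contained in every member of \<open>T\<close>.\<close>

lemma selective_countable_chain:
  assumes sel: "selective_ideal J" and T: "countable T" "T \<subseteq> positive J"
    and chain: "\<And>A B. A \<in> T \<Longrightarrow> B \<in> T \<Longrightarrow> finite (A - B) \<or> finite (B - A)"
  obtains B where "B \<in> positive J" "\<And>A. A \<in> T \<Longrightarrow> finite (B - A)"
proof (cases "T = {}")
  case True
  have "UNIV \<in> positive J"
    using ideal_proper[OF selective_imp_ideal[OF sel]] by (simp add: positive_def)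
  with True that show thesis by blast
next
  case False
  note J = selective_imp_ideal[OF sel]
  define t where "t = from_nat_into T"
  have t: "t n \<in> T" for n using False by (simp add: t_def from_nat_into)
  define C where "C n = (\<Inter>i\<le>n. t i)" for n
  have dec: "decseq C" by (auto simp: C_def decseq_def)
  \<comment> \<open>Positivity of \<open>C n\<close> comes from a member of \<open>T\<close> almost
    contained in it: at each step, whichever of the old member and \<open>t (Suc n)\<close> is
    smaller modulo finite sets.\<close>
  have "\<exists>A\<in>T. finite (A - C n)" for n
  proof (induction n)
    case 0
    have "t 0 - C 0 = {}" by (simp add: C_def)
    with t show ?case by (metis finite.emptyI)
  next
    case (Suc n)
    then obtain A where A: "A \<in> T" "finite (A - C n)" by blast
    have C: "C (Suc n) = C n \<inter> t (Suc n)" by (auto simp: C_def atMost_Suc)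
    from chain[OF A(1) t[of "Suc n"]] show ?case
    proof
      assume "finite (A - t (Suc n))"
      with A have "finite (A - C (Suc n))" by (simp add: C Diff_Int)
      with A show ?thesis by blast
    next
      assume "finite (t (Suc n) - A)"
      moreover have "t (Suc n) - C (Suc n) \<subseteq> (t (Suc n) - A) \<union> (A - C n)" by (auto simp: C)
      ultimately have "finite (t (Suc n) - C (Suc n))"
        using A by (meson finite_UnI finite_subset)
      with t show ?thesis by blast
    qed
  qed
  then have "C n \<in> positive J" for n
    using T(2) ideal_almost_subset[OF J, of "C n"] unfolding positive_def by blast
  from selective_pseudo_intersection[OF sel dec this]
  obtain B where B: "B \<in> positive J" "\<And>n. finite (B - C n)" by blast
  have "finite (B - A)" if "A \<in> T" for A
  proof -
    from from_nat_into_surj[OF T(1) that] obtain n where "A = t n" unfolding t_def by blast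
    then have "B - A \<subseteq> B - C n" by (auto simp: C_def)
    with B(2) show ?thesis by (meson finite_subset)
  qed
  with B(1) that show thesis by blast
qed

text \<open>Rank every point within its fibre. Ranks are at most \<open>m\<close>, so finitely many
  rank classes cover \<open>E\<close> and one is positive; on a rank class \<open>g\<close> is
  injective.\<close>

lemma positive_bounded_fibres_inj:
  fixes g :: "nat \<Rightarrow> nat"
  assumes J: "is_ideal J" and E: "E \<in> positive J"
    and fin: "\<And>n. finite {x\<in>E. g x = n}" and bound: "\<And>n. card {x\<in>E. g x = n} \<le> m"
  obtains C where "C \<in> positive J" "C \<subseteq> E" "inj_on g C"
proof -
  define c where "c x = card {y\<in>E. g y = g x \<and> y < x}" for x
  have less: "c x < c y" if "x \<in> E" "g x = g y" "x < y" for x y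
    unfolding c_def
  proof (rule psubset_card_mono)
    show "finite {z \<in> E. g z = g y \<and> z < y}"
      by (rule finite_subset[OF _ fin[of "g y"]]) auto
    show "{z \<in> E. g z = g x \<and> z < x} \<subset> {z \<in> E. g z = g y \<and> z < y}"
      using that by auto
  qed
  have le: "c x \<le> m" for x
  proof -
    have "c x \<le> card {y\<in>E. g y = g x}"
      unfolding c_def by (intro card_mono fin) auto
    with bound[of "g x"] show ?thesis by simp
  qed
  have "\<exists>i. {x\<in>E. c x = i} \<in> positive J"
  proof (rule ccontr)
    assume "\<not> ?thesis"
    then have "(\<Union>i\<in>{..m}. {x\<in>E. c x = i}) \<in> J"
      by (intro ideal_UN[OF J]) (auto simp: positive_def)
    moreover have "(\<Union>i\<in>{..m}. {x\<in>E. c x = i}) = E" using le by auto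
    ultimately show False using E by (simp add: positive_def)
  qed
  then obtain i where "{x\<in>E. c x = i} \<in> positive J" by blast
  moreover have "inj_on g {x\<in>E. c x = i}"
  proof (rule inj_onI)
    fix x y assume "x \<in> {x\<in>E. c x = i}" "y \<in> {x\<in>E. c x = i}" "g x = g y"
    then show "x = y" using less[of x y] less[of y x] by (cases x y rule: linorder_cases) auto
  qed
  ultimately show thesis using that by blast
qed

text \<open>A decreasing sequence of positive sets pulls back along \<open>f\<close> to such a
  sequence for \<open>K\<close>, and the image of a selector for the pulled-back sequence is a
  selector for the original one.\<close>

lemma selective_ideal_push_forward:
  fixes f :: "'a \<Rightarrow> 'b"
  assumes sel: "selective_ideal K" and fin: "\<And>B. finite B \<Longrightarrow> f -` B \<in> K"
  shows "selective_ideal {B. f -` B \<in> K}" (is "selective_ideal ?J")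
proof (rule selectiveI)
  note K = selective_imp_ideal[OF sel]
  show "is_ideal ?J"
    unfolding is_ideal_def
    using ideal_Un[OF K] ideal_subset[OF K] ideal_proper[OF K] fin
    by (auto simp: vimage_Un) (metis vimage_mono)
  fix A :: "nat \<Rightarrow> 'b set"
  assume A: "decseq A" "\<And>n. A n \<in> positive ?J"
  have "decseq (\<lambda>n. f -` A n)" using A(1) by (auto simp: decseq_def)
  moreover have "f -` A n \<in> positive K" for n using A(2) by (simp add: positive_def)
  ultimately obtain C where C: "C \<in> positive K" "C \<subseteq> f -` A 0"
    "\<And>n x y. x \<in> C \<Longrightarrow> y \<in> C \<Longrightarrow> x \<in> f -` A n - f -` A (Suc n) \<Longrightarrow>
      y \<in> f -` A n - f -` A (Suc n) \<Longrightarrow> x = y"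
    by (rule selectiveE[OF sel]) (rule that)
  have "C \<subseteq> f -` f ` C" by blast
  then have "f ` C \<in> positive ?J"
    using C(1) ideal_subset[OF K] by (auto simp: positive_def)
  moreover have "f ` C \<subseteq> A 0" using C(2) by blast
  moreover have "\<forall>n. \<forall>x\<in>f ` C \<inter> (A n - A (Suc n)). \<forall>y\<in>f ` C \<inter> (A n - A (Suc n)). x = y"
  proof (intro allI ballI)
    fix n x y assume xy: "x \<in> f ` C \<inter> (A n - A (Suc n))" "y \<in> f ` C \<inter> (A n - A (Suc n))"
    then obtain u v where "u \<in> C" "x = f u" "v \<in> C" "y = f v" by blast
    with xy C(3)[of u v n] show "x = y" by simp
  qed
  ultimately show "\<exists>B\<in>positive ?J. B \<subseteq> A 0 \<and>
      (\<forall>n. \<forall>x\<in>B \<inter> (A n - A (Suc n)). \<forall>y\<in>B \<inter> (A n - A (Suc n)). x = y)"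
    by blast
qed

lemma order_via_selective_imp_extendable:
  assumes "is_ideal J" "selective_ideal K" "order_via F J K"
  shows "extendable_to_selective J"
proof -
  obtain f where f: "\<And>B. B \<in> J \<Longrightarrow> f -` B \<in> K"
    using assms(3) by (auto simp: order_via_def)
  then have "selective_ideal {B. f -` B \<in> K}"
    by (intro selective_ideal_push_forward assms(2)) (auto intro: ideal_finite[OF assms(1)])
  with f show ?thesis unfolding extendable_to_selective_def by blast
qed

section \<open>Countable extensions of ideals and the ideal ED\<close>

lemma order_via_mono: "order_via F I K \<Longrightarrow> F \<subseteq> G \<Longrightarrow> order_via G I K"
  unfolding order_via_def by blast

lemma order_via_id: "J \<subseteq> K \<Longrightarrow> order_via one_to_one J K"
  unfolding order_via_def one_to_one_def by (intro bexI[of _ id]) auto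

text \<open>Enlarging \<open>G\<close> brings more ideals \<open>J'\<close> under the universal
  quantifier, so the relation gets stronger.\<close>

lemma prec_omega1_antimono: "prec_omega1 F G I J \<Longrightarrow> H \<subseteq> G \<Longrightarrow> prec_omega1 F H I J"
  unfolding prec_omega1_def by (meson order_via_mono)

lemma one_to_one_subset_fin_to_one: "one_to_one \<subseteq> fin_to_one"
  by (auto simp: one_to_one_def fin_to_one_def intro: finite_vimageI)

lemma subset_extend: "K \<subseteq> extend K \<A>"
  unfolding extend_def by (auto intro!: exI[of _ "{}"])

lemma mem_extend: "is_ideal K \<Longrightarrow> A \<in> \<A> \<Longrightarrow> A \<in> extend K \<A>"
  unfolding extend_def by (auto intro!: exI[of _ "{A}"] ideal_finite)

lemma is_ideal_extend:
  assumes K: "is_ideal K" and "UNIV \<notin> extend K \<A>"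
  shows "is_ideal (extend K \<A>)"
  unfolding is_ideal_def
proof (intro conjI ballI allI impI assms(2))
  fix A B assume "A \<in> extend K \<A>" "B \<in> extend K \<A>"
  then obtain F G where FG: "finite F" "F \<subseteq> \<A>" "A - \<Union>F \<in> K" "finite G" "G \<subseteq> \<A>" "B - \<Union>G \<in> K"
    unfolding extend_def by blast
  have "(A \<union> B) - \<Union>(F \<union> G) \<in> K"
    by (rule ideal_subset[OF K ideal_Un[OF K FG(3,6)]]) auto
  with FG show "A \<union> B \<in> extend K \<A>"
    unfolding extend_def by (intro CollectI exI[of _ "F \<union> G"]) blast
next
  fix A B assume "A \<in> extend K \<A>" and BA: "B \<subseteq> A"
  then obtain F where F: "finite F" "F \<subseteq> \<A>" "A - \<Union>F \<in> K"
    unfolding extend_def by blast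
  have "B - \<Union>F \<in> K" by (rule ideal_subset[OF K F(3)]) (use BA in blast)
  with F(1,2) show "B \<in> extend K \<A>" unfolding extend_def by blast
next
  fix A :: "nat set" assume "finite A"
  then show "A \<in> extend K \<A>" using ideal_finite[OF K] subset_extend by blast
qed

section \<open>Members of \<open>ED_omega\<close>\<close>

lemma ED_omega_iff:
  "B \<in> ED_omega \<longleftrightarrow>
    (\<exists>m. \<forall>\<^sub>\<infinity>n. finite {k. prod_encode (n, k) \<in> B} \<and> card {k. prod_encode (n, k) \<in> B} < m)"
proof -
  have "B \<in> ED_omega \<longleftrightarrow> prod_encode -` B \<in> ED"
  proof
    assume "B \<in> ED_omega"
    then show "prod_encode -` B \<in> ED"
      by (auto simp: ED_omega_def inj_vimage_image_eq[OF inj_prod_encode])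
  next
    assume "prod_encode -` B \<in> ED"
    moreover have "B = prod_encode ` (prod_encode -` B)"
      using surj_prod_encode by (simp add: surj_image_vimage_eq)
    ultimately show "B \<in> ED_omega" unfolding ED_omega_def by blast
  qed
  then show ?thesis by (simp add: ED_def)
qed

lemma columns_below_in_ED_omega: "{y. fst (prod_decode y) < n} \<in> ED_omega"
  unfolding ED_omega_iff
proof (intro exI[of _ "1::nat"] eventually_mono[OF MOST_ge_nat[of n]])
  fix i assume "n \<le> i"
  then have "{k. prod_encode (i, k) \<in> {y. fst (prod_decode y) < n}} = {}" by auto
  then show "finite {k. prod_encode (i, k) \<in> {y. fst (prod_decode y) < n}} \<and>
      card {k. prod_encode (i, k) \<in> {y. fst (prod_decode y) < n}} < 1"
    by (metis card.empty finite.emptyI zero_less_one)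
qed

text \<open>The image has at most one point per column; the bound is \<open>2\<close> because the
  inequality in \<open>ED\<close> is strict.\<close>

lemma image_in_ED_omega:
  assumes "inj_on (\<lambda>x. fst (prod_decode (f x))) B"
  shows "f ` B \<in> ED_omega"
  unfolding ED_omega_iff
proof (intro exI[of _ "2::nat"] always_eventually allI)
  fix n
  have "k = l" if "prod_encode (n, k) \<in> f ` B" "prod_encode (n, l) \<in> f ` B" for k l
  proof -
    from that obtain x y
      where "x \<in> B" "f x = prod_encode (n, k)" "y \<in> B" "f y = prod_encode (n, l)"
      by (auto simp: image_iff)
    with inj_onD[OF assms, of x y] show ?thesis by simp
  qed
  then have "{k. prod_encode (n, k) \<in> f ` B} = {} \<or> (\<exists>a. {k. prod_encode (n, k) \<in> f ` B} = {a})"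
    by blast
  then show "finite {k. prod_encode (n, k) \<in> f ` B} \<and> card {k. prod_encode (n, k) \<in> f ` B} < 2"
    by auto
qed

text \<open>A reduction \<open>f\<close> would make finitely many columns negligible. Selectivity
  then gives a positive \<open>C\<close> almost disjoint from each member of \<open>\<A>\<close>
  with at most one point over each column, so \<open>f\<close> maps \<open>C\<close> into a member
  of \<open>ED_omega\<close>. This puts \<open>C\<close> into \<open>extend K \<A>\<close> and hence
  into \<open>K\<close>.\<close>

lemma selective_not_above_ED:
  assumes sel: "selective_ideal K" and \<A>: "countable \<A>" "UNIV \<notin> extend K \<A>"
  shows "\<not> order_via UNIV ED_omega (extend K \<A>)"
proof
  assume "order_via UNIV ED_omega (extend K \<A>)"
  then obtain f where f: "\<And>B. B \<in> ED_omega \<Longrightarrow> f -` B \<in> extend K \<A>"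
    by (auto simp: order_via_def)
  note K = selective_imp_ideal[OF sel]
  note E = is_ideal_extend[OF K \<A>(2)]
  define col where "col x = fst (prod_decode (f x))" for x
  \<comment> \<open>Adding the empty set allows an enumeration even when \<open>\<A>\<close> is
    empty.\<close>
  define a where "a = from_nat_into (insert {} \<A>)"
  have a: "a i \<in> extend K \<A>" for i
  proof -
    have "a i \<in> insert {} \<A>" unfolding a_def by (rule from_nat_into) simp
    then show ?thesis using mem_extend[OF K] ideal_finite[OF E] by auto
  qed
  define D where "D n = - ((\<Union>i<n. a i) \<union> {x. col x < n})" for n
  have "decseq D"
    unfolding decseq_def D_def by (auto dest: less_le_trans)
  \<comment> \<open>The complement of \<open>D n\<close> lies in \<open>extend K \<A>\<close>; if
    \<open>D n\<close> were in \<open>K\<close>, the whole of \<open>UNIV\<close> would be in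
    \<open>extend K \<A>\<close>.\<close>
  moreover have "D n \<in> positive K" for n
  proof (rule ccontr)
    assume "D n \<notin> positive K"
    then have "D n \<in> extend K \<A>" using subset_extend by (auto simp: positive_def)
    moreover have "(\<Union>i\<in>{..<n}. a i) \<in> extend K \<A>" by (intro ideal_UN[OF E] a) simp
    moreover have "{x. col x < n} \<in> extend K \<A>"
      using f[OF columns_below_in_ED_omega[of n]] by (simp add: col_def vimage_def)
    ultimately have "D n \<union> ((\<Union>i\<in>{..<n}. a i) \<union> {x. col x < n}) \<in> extend K \<A>"
      by (intro ideal_Un[OF E])
    moreover have "D n \<union> ((\<Union>i\<in>{..<n}. a i) \<union> {x. col x < n}) = UNIV"
      by (auto simp: D_def)
    ultimately show False using \<A>(2) by simp
  qed
  ultimately obtain B where B: "B \<in> positive K" "\<And>n. finite (B - D n)"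
    using selective_pseudo_intersection[OF sel, of D] by blast
  obtain C where C: "C \<in> positive K" "C \<subseteq> B" "(\<exists>c. \<forall>x\<in>C. col x = c) \<or> inj_on col C"
    using selective_const_or_inj[OF sel B(1)] by metis
  have "\<not> (\<exists>c. \<forall>x\<in>C. col x = c)"
  proof
    assume "\<exists>c. \<forall>x\<in>C. col x = c"
    then obtain c where "\<forall>x\<in>C. col x = c" by blast
    \<comment> \<open>\<open>D n\<close> omits only the columns below \<open>n\<close>, so the index
      \<open>Suc c\<close> is what excludes column \<open>c\<close>.\<close>
    with C(2) have "C \<subseteq> B - D (Suc c)" by (auto simp: D_def)
    with B(2) positive_infinite[OF K C(1)] show False by (meson finite_subset)
  qed
  with C(3) have "inj_on col C" by blast
  then have "inj_on (\<lambda>x. fst (prod_decode (f x))) C" by (simp add: col_def [abs_def])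
  then have "f -` f ` C \<in> extend K \<A>" by (intro f image_in_ED_omega)
  then have "C \<in> extend K \<A>" by (rule ideal_subset[OF E]) blast
  then obtain F where F: "finite F" "F \<subseteq> \<A>" "C - \<Union>F \<in> K"
    unfolding extend_def by blast
  have "finite (C \<inter> A)" if "A \<in> F" for A
  proof -
    have "countable (insert {} \<A>)" "A \<in> insert {} \<A>" using \<A>(1) F(2) that by auto
    from from_nat_into_surj[OF this] obtain i where "A = a i" unfolding a_def by blast
    then have "C \<inter> A \<subseteq> B - D (Suc i)" using C(2) by (auto simp: D_def)
    with B(2) show ?thesis by (meson finite_subset)
  qed
  then have "finite (\<Union>A\<in>F. C \<inter> A)" using F(1) by blast
  then have "finite (C - (C - \<Union>F))" by (rule finite_subset[rotated]) blast
  with F(3) have "C \<in> K" by (rule ideal_almost_subset[OF K])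
  with C(1) show False by (simp add: positive_def)
qed

text \<open>With the complements of a decreasing sequence as \<open>\<A>\<close>, send
  \<open>x\<close> to column \<open>g x\<close>, the index of the difference containing it. As this
  map is no reduction, some \<open>B\<close> in \<open>ED_omega\<close> has a preimage outside
  \<open>extend K \<A>\<close>. Cut down to a suitable \<open>A N\<close>, this preimage is positive
  and has boundedly many points in each difference.\<close>

lemma not_above_ED_imp_selective:
  assumes K: "is_ideal K"
    and ED: "\<And>\<A>. countable \<A> \<Longrightarrow> UNIV \<notin> extend K \<A> \<Longrightarrow> \<not> order_via UNIV ED_omega (extend K \<A>)"
  shows "selective_ideal K"
proof (rule selectiveI[OF K])
  fix A :: "nat \<Rightarrow> nat set"
  assume dec: "decseq A" and pos: "\<And>n. A n \<in> positive K"
  let ?P = "\<lambda>B. B \<subseteq> A 0 \<and>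
    (\<forall>n. \<forall>x\<in>B \<inter> (A n - A (Suc n)). \<forall>y\<in>B \<inter> (A n - A (Suc n)). x = y)"
  define D where "D = (\<Inter>n. A n)"
  show "\<exists>B\<in>positive K. ?P B"
  \<comment> \<open>The intersection \<open>D\<close> misses all differences, so if positive it is
    itself a selector.\<close>
  proof (cases "D \<in> positive K")
    case True
    then show ?thesis by (intro bexI[of _ D]) (auto simp: D_def)
  next
    case False
    then have D: "D \<in> K" by (simp add: positive_def)
    define \<A> where "\<A> = range (\<lambda>n. - A n)"
    \<comment> \<open>Finitely many complements of the \<open>A n\<close> are all contained in a
      single one, since the sequence decreases.\<close>
    have inter: "\<exists>N. B \<inter> A N \<in> K" if "B \<in> extend K \<A>" for B
    proof -
      from that obtain F where F: "finite F" "F \<subseteq> \<A>" "B - \<Union>F \<in> K"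
        unfolding extend_def by blast
      then obtain I where I: "finite I" "F = (\<lambda>n. - A n) ` I"
        unfolding \<A>_def by (meson finite_subset_image)
      obtain N where "I \<subseteq> {..N}" using I(1) finite_nat_iff_bounded_le by blast
      then have "A N \<subseteq> A i" if "i \<in> I" for i using that dec by (auto simp: decseq_def)
      then have "B \<inter> A N \<subseteq> B - \<Union>F" using I(2) by blast
      with F(3) show ?thesis using ideal_subset[OF K] by blast
    qed
    have "countable \<A>" by (simp add: \<A>_def)
    moreover have "UNIV \<notin> extend K \<A>" using inter[of UNIV] pos by (auto simp: positive_def)
    ultimately have "\<not> order_via UNIV ED_omega (extend K \<A>)" by (rule ED)
    moreover define g where "g x = (LEAST n. x \<notin> A (Suc n))" for x
      \<comment> \<open>unspecified on \<open>D\<close>, which is negligible\<close>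
    ultimately obtain B where B: "B \<in> ED_omega"
      "(\<lambda>x. prod_encode (g x, x)) -` B \<notin> extend K \<A>"
      unfolding order_via_def by blast
    then obtain m N where m: "\<And>n. n \<ge> N \<Longrightarrow>
      finite {k. prod_encode (n, k) \<in> B} \<and> card {k. prod_encode (n, k) \<in> B} < m"
      unfolding ED_omega_iff MOST_nat_le by blast
    \<comment> \<open>Points of \<open>A N\<close> outside \<open>D\<close> have
      \<open>g x \<ge> N\<close>, so the columns of \<open>B\<close> without a guaranteed bound are
      cut off.\<close>
    define E where "E = {x. prod_encode (g x, x) \<in> B} \<inter> A N - D"
    have g: "g x = n" if x: "x \<in> A n - A (Suc n)" for x n
      unfolding g_def
    proof (rule Least_equality)
      fix k assume "x \<notin> A (Suc k)"
      with x dec show "n \<le> k" unfolding decseq_def by (metis DiffD1 not_less_eq_eq subsetD)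
    qed (use x in blast)
    have g_ge: "g x \<ge> N" if x: "x \<in> E" for x
    proof -
      have "x \<notin> D" using x by (simp add: E_def)
      moreover have "x \<in> A 0" using x dec by (auto simp: E_def decseq_def)
      ultimately have "\<exists>n. x \<notin> A (Suc n)" unfolding D_def by (metis INT_I not0_implies_Suc)
      then have "x \<notin> A (Suc (g x))" unfolding g_def by (rule LeastI_ex)
      moreover have "x \<in> A N" using x by (simp add: E_def)
      ultimately show ?thesis using dec unfolding decseq_def by (metis not_less_eq_eq subsetD)
    qed
    have "{x. prod_encode (g x, x) \<in> B} \<inter> A N \<notin> K"
    proof
      assume *: "{x. prod_encode (g x, x) \<in> B} \<inter> A N \<in> K"
      have "{x. prod_encode (g x, x) \<in> B} - \<Union>{- A N} \<in> K"
        using * by (simp add: Diff_eq)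
      then have "{x. prod_encode (g x, x) \<in> B} \<in> extend K \<A>"
        unfolding extend_def \<A>_def by (intro CollectI exI[of _ "{- A N}"]) auto
      with B(2) show False by (simp add: vimage_def)
    qed
    then have "E \<in> positive K"
      unfolding positive_def E_def
      using ideal_Un[OF K _ D] ideal_subset[OF K] by (metis ComplI Un_Diff_cancel2 Un_upper1)
    moreover have "finite {x\<in>E. g x = n} \<and> card {x\<in>E. g x = n} \<le> m" for n
    proof (cases "n \<ge> N")
      case True
      have sub: "{x\<in>E. g x = n} \<subseteq> {k. prod_encode (n, k) \<in> B}" by (auto simp: E_def)
      with m[OF True] have "finite {x\<in>E. g x = n}" by (meson finite_subset)
      moreover have "card {x\<in>E. g x = n} \<le> m"
        using m[OF True] card_mono[OF _ sub] by linarith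
      ultimately show ?thesis by blast
    next
      case False
      then have "{x\<in>E. g x = n} = {}" using g_ge by auto
      then show ?thesis by (simp del: Collect_empty_eq)
    qed
    ultimately obtain C where C: "C \<in> positive K" "C \<subseteq> E" "inj_on g C"
      using positive_bounded_fibres_inj[OF K, of E g m] by blast
    have "C \<subseteq> A 0" using C(2) dec by (auto simp: E_def decseq_def)
    moreover have "x = y" if "x \<in> C \<inter> (A n - A (Suc n))" "y \<in> C \<inter> (A n - A (Suc n))" for x y n
      using that g[of x n] g[of y n] C(3) by (auto dest: inj_onD)
    ultimately show ?thesis using C(1) by blast
  qed
qed

section \<open>Extendability in terms of \<open>prec_omega1\<close>\<close>

lemma extendable_imp_not_prec:
  assumes "extendable_to_selective J"
  shows "\<not> prec_omega1 UNIV one_to_one ED_omega J"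
proof -
  obtain K where "selective_ideal K" "J \<subseteq> K"
    using assms unfolding extendable_to_selective_def by blast
  with selective_not_above_ED[of K] selective_imp_ideal[of K] order_via_id[of J K]
  show ?thesis unfolding prec_omega1_def by blast
qed

text \<open>An ideal \<open>K\<close> refuting the relation is selective, and its push-forward along
  a map witnessing \<open>order_via G J K\<close> contains \<open>J\<close>.\<close>

lemma not_prec_imp_extendable:
  assumes "is_ideal J" "\<not> prec_omega1 UNIV G ED_omega J"
  shows "extendable_to_selective J"
proof -
  obtain K where K: "is_ideal K" "order_via G J K"
    and ED: "\<not> (\<exists>\<A>. countable \<A> \<and> UNIV \<notin> extend K \<A> \<and> order_via UNIV ED_omega (extend K \<A>))"
    using assms(2) unfolding prec_omega1_def by auto
  have "selective_ideal K"
    by (rule not_above_ED_imp_selective[OF K(1)]) (use ED in blast)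
  then show ?thesis by (rule order_via_selective_imp_extendable[OF assms(1) _ K(2)])
qed

section \<open>Selective ultrafilters under CH\<close>

lemma mem_dual_iff: "A \<in> dual U \<longleftrightarrow> - A \<in> U"
  unfolding dual_def by (auto intro: image_eqI[of _ _ "- A"])

lemma is_ideal_dual:
  assumes "is_ultrafilter U"
  shows "is_ideal (dual U)"
  unfolding is_ideal_def
proof (intro conjI ballI allI impI)
  show "A \<union> B \<in> dual U" if "A \<in> dual U" "B \<in> dual U" for A B
    using assms that unfolding is_ultrafilter_def mem_dual_iff Compl_Un by metis
  show "B \<in> dual U" if "A \<in> dual U" "B \<subseteq> A" for A B
    using assms that Compl_anti_mono[of B A] unfolding is_ultrafilter_def mem_dual_iff by metis
  show "A \<in> dual U" if "finite A" for A
    using assms that unfolding is_ultrafilter_def mem_dual_iff by simp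
  show "UNIV \<notin> dual U"
    using assms by (simp add: is_ultrafilter_def mem_dual_iff)
qed

text \<open>A cardinal well-order of the power set of the naturals has proper initial segments of
  smaller cardinality, countable by \<open>CH\<close>. It serves as the first uncountable
  ordinal.\<close>

lemma CH_wellorder:
  assumes CH
  obtains r :: "nat set rel" where "Well_order r" "Field r = UNIV" "\<And>x. countable (underS r x)"
proof -
  let ?r = "card_of (UNIV :: nat set set)"
  have "countable (underS ?r x)" for x
  proof -
    have "(card_of (underS ?r x), ?r) \<in> ordLess"
      by (rule card_of_underS[OF card_of_Card_order]) (simp add: Field_card_of)
    then have "(card_of (underS ?r x), cardSuc natLeq) \<in> ordLess"
      using assms unfolding CH_def by (rule ordLess_ordIso_trans)
    then have "(card_of (underS ?r x), natLeq) \<in> ordLeq"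
      by (simp add: cardSuc_ordLeq_ordLess natLeq_Card_order card_of_Card_order)
    then have "(card_of (underS ?r x), card_of (UNIV :: nat set)) \<in> ordLeq"
      using card_of_nat ordIso_symmetric ordLeq_ordIso_trans by blast
    then show ?thesis unfolding countable_def card_of_ordLeq[symmetric] by blast
  qed
  then show thesis by (rule that[OF card_of_Well_order Field_card_of])
qed

text \<open>The tower decides every function by constancy or injectivity. Characteristic functions
  make the generated filter an ultrafilter; functions recording where points leave a decreasing
  sequence make it selective.\<close>

lemma CH_selective_ultrafilter:
  fixes K :: "nat set set"
  assumes CH and sel: "selective_ideal K"
  obtains U where "selective_ultrafilter U" "K \<subseteq> dual U"
proof -
  note K = selective_imp_ideal[OF sel]
  obtain r :: "nat set rel" where r: "Well_order r" "Field r = UNIV"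
    and count: "\<And>x. countable (underS r x)"
    using CH_wellorder[OF \<open>CH\<close>] by blast
  \<comment> \<open>Coding functions by their graphs lets the index type \<open>nat set\<close> list
    all functions; \<open>inv\<close> is arbitrary on sets that are not graphs.\<close>
  have inj: "inj (\<lambda>g :: nat \<Rightarrow> nat. {prod_encode (x, g x) |x. True})"
  proof (rule injI)
    fix g h :: "nat \<Rightarrow> nat"
    assume "{prod_encode (x, g x) |x. True} = {prod_encode (x, h x) |x. True}"
    then have "\<exists>y. prod_encode (x, g x) = prod_encode (y, h y)" for x by blast
    then show "g = h" by (auto simp: prod_encode_eq)
  qed
  define func where "func = inv (\<lambda>g :: nat \<Rightarrow> nat. {prod_encode (x, g x) |x. True})"
  have surj: "\<exists>\<alpha>. func \<alpha> = g" for g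
    using inv_f_f[OF inj] unfolding func_def by blast
  let ?P = "\<lambda>b \<alpha> B. B \<in> positive K \<and> (\<forall>\<beta>\<in>underS r \<alpha>. finite (B - b \<beta>)) \<and>
    ((\<exists>c. \<forall>x\<in>B. func \<alpha> x = c) \<or> inj_on (func \<alpha>) B)"
  have underS: "\<beta> \<in> underS r \<alpha> \<longleftrightarrow> (\<beta>, \<alpha>) \<in> r - Id" for \<alpha> \<beta> by (auto simp: underS_def)
  have total: "\<beta> \<in> underS r \<alpha> \<or> \<alpha> \<in> underS r \<beta> \<or> \<alpha> = \<beta>" for \<alpha> \<beta>
    using r unfolding underS well_order_on_def linear_order_on_def total_on_def by blast
  have "\<exists>b. \<forall>\<alpha>. ?P b \<alpha> (b \<alpha>)"
  \<comment> \<open>Recursion along the well-order: stage \<alpha> must be positive, almost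
    contained in all earlier stages, and decide \<open>func \<alpha>\<close>.\<close>
  proof (rule dependent_wf_choice[of "r - Id" ?P])
    show "wf (r - Id)" using r(1) by (simp add: well_order_on_def)
    show "?P b \<alpha> B = ?P b' \<alpha> B" if "\<And>\<beta>. (\<beta>, \<alpha>) \<in> r - Id \<Longrightarrow> b \<beta> = b' \<beta>" for b b' \<alpha> B
      using that underS by metis
  next
    fix \<alpha> b assume IH: "\<And>\<beta>. (\<beta>, \<alpha>) \<in> r - Id \<Longrightarrow> ?P b \<beta> (b \<beta>)"
    have count': "countable (b ` underS r \<alpha>)" by (rule countable_image[OF count])
    have pos': "b ` underS r \<alpha> \<subseteq> positive K" using IH underS by blast
    have chain: "finite (A - B) \<or> finite (B - A)"
      if AB: "A \<in> b ` underS r \<alpha>" "B \<in> b ` underS r \<alpha>" for A B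
    proof -
      obtain \<beta> \<gamma> where bc: "\<beta> \<in> underS r \<alpha>" "A = b \<beta>" "\<gamma> \<in> underS r \<alpha>" "B = b \<gamma>"
        using AB by blast
      have "?P b \<beta> (b \<beta>)" "?P b \<gamma> (b \<gamma>)" using IH bc underS by blast+
      with bc total[of \<beta> \<gamma>] show ?thesis by auto
    qed
    obtain B where B: "B \<in> positive K" "\<And>A. A \<in> b ` underS r \<alpha> \<Longrightarrow> finite (B - A)"
      by (rule selective_countable_chain[OF sel count' pos'])
        ((rule chain; assumption) | rule that)+
    obtain C where C: "C \<in> positive K" "C \<subseteq> B"
      "(\<exists>c. \<forall>x\<in>C. func \<alpha> x = c) \<or> inj_on (func \<alpha>) C"
      using selective_const_or_inj[OF sel B(1)] by metis
    have "finite (C - b \<beta>)" if "\<beta> \<in> underS r \<alpha>" for \<beta>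
      by (rule finite_subset[OF _ B(2)[OF imageI[OF that]]]) (use C(2) in blast)
    with C show "\<exists>B. ?P b \<alpha> B" by blast
  qed
  then obtain b where b: "\<And>\<alpha>. ?P b \<alpha> (b \<alpha>)" by blast
  then have inf: "infinite (b \<alpha>)" for \<alpha> using positive_infinite[OF K] by blast
  define U where "U = {X. \<exists>\<alpha>. finite (b \<alpha> - X)}"
  have U_memI: "X \<in> U" if "b \<alpha> \<subseteq> X" for X \<alpha>
  proof -
    have "b \<alpha> - X = {}" using that by blast
    then show ?thesis unfolding U_def by (metis (mono_tags) CollectI finite.emptyI)
  qed
  \<comment> \<open>A two-valued function is not injective on an infinite set, so the characteristic
    function of \<open>X\<close> is constant at its stage.\<close>
  have decide: "\<exists>\<alpha>. b \<alpha> \<subseteq> X \<or> b \<alpha> \<subseteq> - X" for X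
  proof -
    obtain \<alpha> where \<alpha>: "func \<alpha> = of_bool \<circ> (\<lambda>x. x \<in> X)" using surj by blast
    have "\<not> inj_on (func \<alpha>) (b \<alpha>)"
    proof
      assume "inj_on (func \<alpha>) (b \<alpha>)"
      moreover have "func \<alpha> ` b \<alpha> \<subseteq> {0, 1}" by (auto simp: \<alpha>)
      ultimately show False using inf by (meson finite.intros finite_subset finite_image_iff)
    qed
    with b[of \<alpha>] obtain c where "\<forall>x\<in>b \<alpha>. func \<alpha> x = c" by blast
    then have "\<forall>x\<in>b \<alpha>. \<forall>y\<in>b \<alpha>. x \<in> X \<longleftrightarrow> y \<in> X" unfolding \<alpha> comp_def by (metis of_bool_eq_iff)
    then have "b \<alpha> \<subseteq> X \<or> b \<alpha> \<subseteq> - X" by blast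
    then show ?thesis by blast
  qed
  have Int: "X \<inter> Y \<in> U" if XY: "X \<in> U" "Y \<in> U" for X Y
  proof -
    obtain \<alpha> \<beta> where ab: "finite (b \<alpha> - X)" "finite (b \<beta> - Y)" using XY by (auto simp: U_def)
    \<comment> \<open>The later of the two indices serves as \<gamma>.\<close>
    have "\<exists>\<gamma>. finite (b \<gamma> - b \<alpha>) \<and> finite (b \<gamma> - b \<beta>)"
      using total[of \<alpha> \<beta>] b[of \<alpha>] b[of \<beta>] by (metis Diff_cancel finite.emptyI)
    then obtain \<gamma> where "finite (b \<gamma> - b \<alpha>)" "finite (b \<gamma> - b \<beta>)" by blast
    with ab have "finite ((b \<gamma> - b \<alpha>) \<union> (b \<gamma> - b \<beta>) \<union> (b \<alpha> - X) \<union> (b \<beta> - Y))" by simp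
    then have "finite (b \<gamma> - X \<inter> Y)" by (rule finite_subset[rotated]) blast
    then show ?thesis by (auto simp: U_def)
  qed
  have ultra: "is_ultrafilter U"
    unfolding is_ultrafilter_def
  proof (intro conjI ballI allI impI)
    show "{} \<notin> U" using inf by (simp add: U_def)
    show "A \<inter> B \<in> U" if "A \<in> U" "B \<in> U" for A B using Int that .
    show "B \<in> U" if AB: "A \<in> U" "A \<subseteq> B" for A B
    proof -
      obtain \<alpha> where "finite (b \<alpha> - A)" using AB(1) by (auto simp: U_def)
      then have "finite (b \<alpha> - B)" by (rule finite_subset[rotated]) (use AB(2) in blast)
      then show ?thesis by (auto simp: U_def)
    qed
    show "A \<in> U \<or> - A \<in> U" for A using decide U_memI by blast
    show "A \<in> U" if "finite (- A)" for A
      using that unfolding U_def by (auto simp: Diff_eq)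
  qed
  have U_empty: "{} \<notin> U" using ultra by (simp add: is_ultrafilter_def)
  have U_up: "A \<in> U \<Longrightarrow> A \<subseteq> B \<Longrightarrow> B \<in> U" for A B using ultra by (simp add: is_ultrafilter_def)
  have U_dec: "A \<in> U \<or> - A \<in> U" for A using ultra by (simp add: is_ultrafilter_def)
  have "A \<in> positive (dual U) \<longleftrightarrow> A \<in> U" for A
    using U_dec[of A] Int[of A "- A"] U_empty by (auto simp: positive_def mem_dual_iff)
  then have pos: "positive (dual U) = U" by blast
  have "selective_ideal (dual U)"
  proof (rule selectiveI[OF is_ideal_dual[OF ultra]], unfold pos)
    fix A :: "nat \<Rightarrow> nat set"
    assume dec: "decseq A" and A: "\<And>n. A n \<in> U"
    let ?P = "\<lambda>B. B \<subseteq> A 0 \<and>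
      (\<forall>n. \<forall>x\<in>B \<inter> (A n - A (Suc n)). \<forall>y\<in>B \<inter> (A n - A (Suc n)). x = y)"
    define D where "D = (\<Inter>n. A n)"
    show "\<exists>B\<in>U. ?P B"
    proof (cases "D \<in> U")
      case True
      then show ?thesis by (intro bexI[of _ D]) (auto simp: D_def)
    next
      case False
      \<comment> \<open>Here the difference with index \<open>n\<close> gets the value
        \<open>Suc n\<close>, as \<open>0\<close> marks the points outside
        \<open>A 0\<close>.\<close>
      define g where "g x = (LEAST n. x \<notin> A n)" for x
      have g: "g x = Suc n" if x: "x \<in> A n - A (Suc n)" for x n
        unfolding g_def
      proof (rule Least_equality)
        fix k assume "x \<notin> A k"
        with x dec show "Suc n \<le> k" unfolding decseq_def by (metis DiffD1 not_less_eq_eq subsetD)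
      qed (use x in blast)
      have g_not: "x \<notin> A (g x)" if "x \<notin> D" for x
        unfolding g_def by (rule LeastI_ex) (use that in \<open>auto simp: D_def\<close>)
      obtain \<alpha> where \<alpha>: "func \<alpha> = g" using surj by blast
      have bU: "b \<alpha> \<inter> - D \<in> U" using Int U_memI[of \<alpha> "b \<alpha>"] U_dec[of D] False by blast
      have "\<not> (\<exists>c. \<forall>x\<in>b \<alpha>. g x = c)"
      proof
        assume "\<exists>c. \<forall>x\<in>b \<alpha>. g x = c"
        then obtain c where "\<forall>x\<in>b \<alpha>. g x = c" by blast
        \<comment> \<open>Points outside \<open>D\<close> with \<open>g x = c\<close> are missing
          from \<open>A c\<close>, although all three sets intersected here belong to
          \<open>U\<close>.\<close>
        then have "b \<alpha> \<inter> - D \<inter> A c = {}" using g_not by fastforce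
        with Int[OF bU A] U_empty show False by metis
      qed
      then have inj_g: "inj_on g (b \<alpha>)" using b[of \<alpha>] \<alpha> by blast
      have "x = y" if "x \<in> b \<alpha> \<inter> (A n - A (Suc n))" "y \<in> b \<alpha> \<inter> (A n - A (Suc n))" for x y n
        using that g[of x n] g[of y n] inj_onD[OF inj_g, of x y] by auto
      moreover have "b \<alpha> \<inter> A 0 \<in> U" using Int[OF U_memI[of \<alpha> "b \<alpha>"] A] by blast
      ultimately show ?thesis by (intro bexI[of _ "b \<alpha> \<inter> A 0"]) blast+
    qed
  qed
  moreover have "K \<subseteq> dual U"
  proof
    fix X assume "X \<in> K"
    obtain \<alpha> where "b \<alpha> \<subseteq> X \<or> b \<alpha> \<subseteq> - X" using decide by blast
    moreover have "\<not> b \<alpha> \<subseteq> X"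
      using b[of \<alpha>] ideal_subset[OF K \<open>X \<in> K\<close>] by (auto simp: positive_def)
    ultimately show "X \<in> dual U" using U_memI by (auto simp: mem_dual_iff)
  qed
  ultimately show thesis using that ultra by (simp add: selective_ultrafilter_def)
qed

theorem theorem9p3:
  fixes J :: "nat set set"
  assumes "is_ideal J"
  shows
    "((extendable_to_selective J \<longleftrightarrow> \<not> prec_omega1 UNIV one_to_one ED_omega J) \<and>
      (extendable_to_selective J \<longleftrightarrow> \<not> prec_omega1 UNIV fin_to_one ED_omega J) \<and>
      (extendable_to_selective J \<longleftrightarrow> \<not> prec_omega1 UNIV UNIV ED_omega J)) \<and>
     (CH \<longrightarrow>
      (extendable_to_selective J \<longleftrightarrow> (\<exists>U. selective_ultrafilter U \<and> \<not> J_point J U)) \<and>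
      (extendable_to_selective J \<longleftrightarrow> (\<exists>U. selective_ultrafilter U \<and> \<not> weak_J_ultrafilter J U)) \<and>
      (extendable_to_selective J \<longleftrightarrow> (\<exists>U. selective_ultrafilter U \<and> \<not> J_ultrafilter J U)))"
proof -
  \<comment> \<open>All three classes contain \<open>one_to_one\<close>: failure of the relation
    passes from that smallest class to \<open>G\<close>, and failure for any \<open>G\<close> gives
    extendability.\<close>
  have prec: "extendable_to_selective J \<longleftrightarrow> \<not> prec_omega1 UNIV G ED_omega J"
    if "one_to_one \<subseteq> G" for G
    using extendable_imp_not_prec not_prec_imp_extendable[OF assms] prec_omega1_antimono[OF _ that]
    by blast
  \<comment> \<open>The identity, which lies in every such \<open>G\<close>, gives one direction;
    pushing forward the dual ideal gives the other.\<close>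
  have ultra: "extendable_to_selective J \<longleftrightarrow>
      (\<exists>U. selective_ultrafilter U \<and> order_via G J (dual U))"
    if G: "one_to_one \<subseteq> G" and CH for G
  proof
    assume "extendable_to_selective J"
    then obtain K where K: "selective_ideal K" "J \<subseteq> K"
      unfolding extendable_to_selective_def by blast
    obtain U where "selective_ultrafilter U" "K \<subseteq> dual U"
      using CH_selective_ultrafilter[OF \<open>CH\<close> K(1)] by blast
    with K(2) G show "\<exists>U. selective_ultrafilter U \<and> order_via G J (dual U)"
      by (meson order_via_id order_via_mono subset_trans)
  next
    assume "\<exists>U. selective_ultrafilter U \<and> order_via G J (dual U)"
    then show "extendable_to_selective J"
      using order_via_selective_imp_extendable[OF assms]
      unfolding selective_ultrafilter_def by blast
  qed
  show ?thesis
    unfolding J_point_def weak_J_ultrafilter_def J_ultrafilter_def not_not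
    using prec[OF order_refl] prec[OF one_to_one_subset_fin_to_one] prec[OF subset_UNIV]
      ultra[OF order_refl] ultra[OF one_to_one_subset_fin_to_one] ultra[OF subset_UNIV]
    by (intro conjI impI) assumption+
qed

end
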